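(* Let $V$ be a finite set and let $\mathcal{X}\subsetneq 2^V$ be woven. Then there is an $X\subseteq V$ such that $X\notin\mathcal{X}$ and $\mathcal{X}\cup\{X\}$ is again woven.
   Context: A finite set $\mathcal{Y}$ of finite sets is woven if for all $X,Y\in\mathcal{Y}$ at least one of $X\cup Y$ and $X\cap Y$ is in $\mathcal{Y}$. *)

theory Defs
  imports Main
begin

definition woven :: "'a set set \<Rightarrow> bool" where
  "woven \<Y> \<longleftrightarrow> finite \<Y> \<and> (\<forall>X\<in>\<Y>. finite X) \<and>
     (\<forall>X\<in>\<Y>. \<forall>Y\<in>\<Y>. X \<union> Y \<in> \<Y> \<or> X \<inter> Y \<in> \<Y>)"

end

theory Submission
  imports Defs
begin

text \<open>
  A set \<open>X\<close> all of whose proper subsets lie in a woven family can always be added to it: for every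
  other set \<open>Y\<close>, the intersection \<open>X \<inter> Y\<close> is either \<open>X\<close> itself or a proper subset of \<open>X\<close>, so the
  intersection alternative of wovenness holds for every new pair.  An inclusion-minimal element of
  \<open>Pow V - \<X>\<close> is such a set \<open>X\<close>, and it exists because \<open>Pow V\<close> is finite.
\<close>

lemma woven_insert_if_proper_subsets_mem:
  assumes "woven \<X>" and "finite X" and proper: "\<And>Z. Z \<subset> X \<Longrightarrow> Z \<in> \<X>"
  shows "woven (insert X \<X>)"
proof -
  have Int: "X \<inter> Y \<in> insert X \<X>" for Y
    using proper[of "X \<inter> Y"] by blast
  have "A \<union> B \<in> insert X \<X> \<or> A \<inter> B \<in> insert X \<X>"
    if "A \<in> insert X \<X>" "B \<in> insert X \<X>" for A B
  proof (cases "A = X \<or> B = X")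
    case True
    then show ?thesis using Int[of A] Int[of B] by (metis Int_commute)
  next
    case False
    then have "A \<in> \<X>" "B \<in> \<X>" using that by blast+
    then show ?thesis using \<open>woven \<X>\<close> unfolding woven_def by blast
  qed
  moreover have "finite (insert X \<X>)" "\<forall>A\<in>insert X \<X>. finite A"
    using \<open>woven \<X>\<close> \<open>finite X\<close> unfolding woven_def by simp_all
  ultimately show ?thesis
    unfolding woven_def by blast
qed

theorem corollary2p3:
  fixes V :: "'a set" and \<X> :: "'a set set"
  assumes "finite V"
    and "\<X> \<subset> Pow V"
    and "woven \<X>"
  shows "\<exists>X. X \<subseteq> V \<and> X \<notin> \<X> \<and> woven (\<X> \<union> {X})"
proof -
  have "finite (Pow V - \<X>)" "Pow V - \<X> \<noteq> {}"
    using assms(1,2) by auto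
  then obtain X where X: "X \<in> Pow V - \<X>"
    and minimal: "\<And>Z. Z \<in> Pow V - \<X> \<Longrightarrow> Z \<subseteq> X \<Longrightarrow> X = Z"
    using finite_has_minimal[of "Pow V - \<X>"] by metis
  have "woven (insert X \<X>)"
  proof (rule woven_insert_if_proper_subsets_mem)
    show "woven \<X>" by fact
    show "finite X"
      using X assms(1) by (meson DiffD1 PowD finite_subset)
    show "Z \<in> \<X>" if "Z \<subset> X" for Z
    proof (rule ccontr)
      assume "Z \<notin> \<X>"
      moreover have "Z \<subseteq> V" using that X by auto
      ultimately have "X = Z" using minimal that by auto
      then show False using that by simp
    qed
  qed
  then show ?thesis using X by auto
qed

end
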